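(* Let $\Sigma$ be a finite alphabet and let $X\subset\Sigma^{\mathbb Z}$ be a subshift. Then $X$ admits a residually defined $g$-function if and only if $X$ has property $(D)$.
   Context: Subshifts. $\Sigma$ is a finite (discrete) alphabet, $S$ is the shift on $\Sigma^{\mathbb Z}$, $(Sx)_i=x_{i+1}$. A subshift is a closed $S$-invariant set $X\subset\Sigma^{\mathbb Z}$. A finite word is admissible for $X$ if it appears in some point of $X$. For an interval $J\subset\mathbb Z$ (finite or infinite), $x_J=(x_j)_{j\in J}$ and $X_J=\{x_J:x\in X\}$, with the product topology. Blocks are identified with the words they carry, up to translation of indices. A subset of a compact space is residual if it contains a dense $G_\delta$. Contexts. For $x^-\in X_{(-\infty,0]}$ and $n\in\mathbb N$: $\Gamma_n^+(x^-)=\{b\in X_{[1,n]}:(x^-,b)\in X_{(-\infty,n]}\}$. For an admissible word $a$: $\Gamma_n^+(a)$ is the set of words $b$ of length $n$ with $ab$ admissible, $\Gamma^-(a)$ is the set of finite words $c$ with $ca$ admissible, and $\Gamma^-_\infty(a)$ is the set of left-infinite sequences $x^-$ such that $(x^-,a)$ is (up to translation) an element of $X_{(-\infty,0]}$. For an admissible word $a$: $\omega_n^+(a)=\bigcap_{x^-\in\Gamma^-_\infty(a)}\{b\in X_{[1,n]}:(x^-,a,b)\in X_{(-\infty,n]}\}$. Property $(D)$: for every admissible word $b\sigma$ of $X$ ($b$ a word, $\sigma\in\Sigma$) there is a word $a\in\Gamma^-(b)$ such that $\sigma\in\omega_1^+(ab)$. Residually defined $g$-function of $X$: a continuous function $g:D^-(g)\times\Sigma\to[0,1]$,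 where $D^-(g)$ is a residual subset of $X_{(-\infty,0]}$, such that: (i) $\sum_{\sigma\in\Gamma_1^+(x^-)}g(x^-,\sigma)=1$ for $x^-\in D^-(g)$, and $g(x^-,\sigma)=0$ if $\sigma\notin\Gamma_1^+(x^-)$; (ii) there is no point of $X_{(-\infty,0]}\setminus D^-(g)$ to which the mapping $x^-\mapsto(g(x^-,\sigma))_{\sigma\in\Sigma}$ $(x^-\in D^-(g))$ can be extended by continuity; (iii) $X_{(-\infty,1]}=\overline{\{(x^-,\alpha):x^-\in D^-(g),\ \alpha\in\Gamma_1^+(x^-),\ g(x^-,\alpha)>0\}}$. *)

theory Defs
  imports "HOL-Analysis.Analysis"
begin

text \<open>The alphabet is a finite set \<open>A\<close>. A sequence indexed by \<open>J\<close> is an element of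
  \<open>J \<rightarrow>\<^sub>E A\<close>, so it takes the value \<^term>\<open>undefined\<close> off \<open>J\<close>. Words are lists.\<close>

abbreviation seq_topology :: "'a set \<Rightarrow> int set \<Rightarrow> (int \<Rightarrow> 'a) topology" where
  "seq_topology A J \<equiv> product_topology (\<lambda>_. discrete_topology A) J"

definition shift :: "(int \<Rightarrow> 'a) \<Rightarrow> int \<Rightarrow> 'a" where
  "shift x = (\<lambda>i. x (i + 1))"

definition subshift :: "'a set \<Rightarrow> (int \<Rightarrow> 'a) set \<Rightarrow> bool" where
  "subshift A X \<longleftrightarrow> closedin (seq_topology A UNIV) X \<and> shift ` X = X"

text \<open>\<open>X\<^sub>J\<close>\<close>
definition proj :: "(int \<Rightarrow> 'a) set \<Rightarrow> int set \<Rightarrow> (int \<Rightarrow> 'a) set" where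
  "proj X J = (\<lambda>x. restrict x J) ` X"

abbreviation proj_topology :: "'a set \<Rightarrow> (int \<Rightarrow> 'a) set \<Rightarrow> int set \<Rightarrow> (int \<Rightarrow> 'a) topology" where
  "proj_topology A X J \<equiv> subtopology (seq_topology A J) (proj X J)"

text \<open>\<open>X\<^bsub>[1,n]\<^esub>\<close>, with blocks written as words\<close>
definition blocks :: "(int \<Rightarrow> 'a) set \<Rightarrow> nat \<Rightarrow> 'a list set" where
  "blocks X n = (\<lambda>x. map x [1..int n]) ` X"

definition admissible :: "(int \<Rightarrow> 'a) set \<Rightarrow> 'a list \<Rightarrow> bool" where
  "admissible X a \<longleftrightarrow> (\<exists>x\<in>X. \<exists>i. \<forall>k<length a. x (i + int k) = a ! k)"

text \<open>\<open>(x\<^sup>-, b)\<close> for \<open>x\<^sup>-\<close> indexed by \<open>(-\<infinity>, 0]\<close>; the result is indexed by \<open>(-\<infinity>, length b]\<close>.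
  Applying \<^const>\<open>shift\<close> \<open>k\<close> times translates the index set to \<open>(-\<infinity>, length b - k]\<close>.\<close>
definition append_word :: "(int \<Rightarrow> 'a) \<Rightarrow> 'a list \<Rightarrow> int \<Rightarrow> 'a" where
  "append_word x b =
     (\<lambda>i. if i \<le> 0 then x i else if i \<le> int (length b) then b ! nat (i - 1) else undefined)"

text \<open>\<open>\<Gamma>\<^sub>n\<^sup>+(x\<^sup>-)\<close>\<close>
definition future_context :: "(int \<Rightarrow> 'a) set \<Rightarrow> nat \<Rightarrow> (int \<Rightarrow> 'a) \<Rightarrow> 'a list set" where
  "future_context X n x = {b \<in> blocks X n. append_word x b \<in> proj X {..int n}}"

text \<open>\<open>\<Gamma>\<^sub>1\<^sup>+(x\<^sup>-)\<close> as a set of symbols\<close>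
abbreviation next_symbols :: "(int \<Rightarrow> 'a) set \<Rightarrow> (int \<Rightarrow> 'a) \<Rightarrow> 'a set" where
  "next_symbols X x \<equiv> {\<sigma>. [\<sigma>] \<in> future_context X 1 x}"

text \<open>\<open>\<Gamma>\<^sup>-(a)\<close>\<close>
definition past_context :: "(int \<Rightarrow> 'a) set \<Rightarrow> 'a list \<Rightarrow> 'a list set" where
  "past_context X a = {c. admissible X (c @ a)}"

text \<open>\<open>\<Gamma>\<^sub>\<infinity>\<^sup>-(a)\<close>\<close>
definition past_context_inf :: "'a set \<Rightarrow> (int \<Rightarrow> 'a) set \<Rightarrow> 'a list \<Rightarrow> (int \<Rightarrow> 'a) set" where
  "past_context_inf A X a =
     {x \<in> {..0} \<rightarrow>\<^sub>E A. (shift ^^ length a) (append_word x a) \<in> proj X {..0}}"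

text \<open>\<open>\<omega>\<^sub>n\<^sup>+(a)\<close>, meant for admissible \<open>a\<close> only: otherwise the intersection is over the
  empty family.\<close>
definition omega_plus :: "'a set \<Rightarrow> (int \<Rightarrow> 'a) set \<Rightarrow> nat \<Rightarrow> 'a list \<Rightarrow> 'a list set" where
  "omega_plus A X n a =
     (\<Inter>x\<in>past_context_inf A X a.
        {b \<in> blocks X n. (shift ^^ length a) (append_word x (a @ b)) \<in> proj X {..int n}})"

definition property_D :: "'a set \<Rightarrow> (int \<Rightarrow> 'a) set \<Rightarrow> bool" where
  "property_D A X \<longleftrightarrow>
     (\<forall>b \<sigma>. admissible X (b @ [\<sigma>]) \<longrightarrow>
        (\<exists>a\<in>past_context X b. [\<sigma>] \<in> omega_plus A X 1 (a @ b)))"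

definition residual_in :: "'b topology \<Rightarrow> 'b set \<Rightarrow> bool" where
  "residual_in T S \<longleftrightarrow>
     S \<subseteq> topspace T \<and> (\<exists>G\<subseteq>S. gdelta_in T G \<and> T closure_of G = topspace T)"

text \<open>\<open>D\<close> is the domain \<open>D\<^sup>-(g)\<close>; the values of \<open>g\<close> outside \<open>D \<times> A\<close> are irrelevant.\<close>
definition residually_defined_g_function ::
    "'a set \<Rightarrow> (int \<Rightarrow> 'a) set \<Rightarrow> (int \<Rightarrow> 'a) set \<Rightarrow> ((int \<Rightarrow> 'a) \<Rightarrow> 'a \<Rightarrow> real) \<Rightarrow> bool" where
  "residually_defined_g_function A X D g \<longleftrightarrow>
     residual_in (proj_topology A X {..0}) D \<and>
     continuous_map
       (prod_topology (subtopology (proj_topology A X {..0}) D) (discrete_topology A))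
       (top_of_set {0..1}) (\<lambda>(x, \<sigma>). g x \<sigma>) \<and>
     (\<forall>x\<in>D. (\<Sum>\<sigma>\<in>next_symbols X x. g x \<sigma>) = 1 \<and> (\<forall>\<sigma>\<in>A - next_symbols X x. g x \<sigma> = 0)) \<and>
     (\<forall>y\<in>proj X {..0} - D.
        \<not> (\<exists>h. continuous_map (subtopology (proj_topology A X {..0}) (insert y D))
                 (product_topology (\<lambda>_. euclideanreal) A) h \<and>
               (\<forall>x\<in>D. h x = restrict (g x) A))) \<and>
     proj X {..1} =
       seq_topology A {..1} closure_of
         {append_word x [\<alpha>] | x \<alpha>. x \<in> D \<and> \<alpha> \<in> next_symbols X x \<and> g x \<alpha> > 0}"

end

theory Submission
  imports Defs
begin

text \<open>
  Write \<open>F \<sigma>\<close> for the set of pasts that \<open>\<sigma>\<close> may follow. It is closed by compactness of \<open>X\<close>, and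
  \<open>\<sigma> \<in> \<omega>\<^sub>1\<^sup>+(w)\<close> says that the cylinder of pasts ending in \<open>w\<close> lies in \<open>F \<sigma>\<close>.
  If a g-function exists and \<open>b\<sigma>\<close> is admissible, then by (iii) some past \<open>x\<close> in its domain ends
  in \<open>b\<close> and has \<open>g x \<sigma> > 0\<close>. By continuity this persists on the intersection of the domain with
  a cylinder around \<open>x\<close>, and since the domain is dense and \<open>F \<sigma>\<close> is closed, the whole cylinder
  lies in \<open>F \<sigma>\<close>.
  Conversely, the complement \<open>E\<close> of the frontiers of the sets \<open>F \<sigma>\<close> is open and dense, and the
  set of possible next symbols is locally constant on it, so the uniform distribution on the next
  symbols is continuous on \<open>E\<close>. Extending it to all points to which it extends continuously
  yields (i) and (ii) by density; property (D) is needed only for (iii).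
\<close>

section \<open>Words and contexts\<close>

lemma shift_funpow: "(shift ^^ k) x = (\<lambda>i. x (i + int k))"
  by (induction k arbitrary: x) (auto simp: shift_def algebra_simps)

lemma subshift_translate:
  assumes "subshift A X" "x \<in> X"
  shows "(\<lambda>i. x (i + m)) \<in> X"
proof -
  have img: "shift ` X = X"
    using assms by (simp add: subshift_def)
  have forward: "(\<lambda>i. y (i + int k)) \<in> X" if "y \<in> X" for y k
  proof (induction k)
    case (Suc k)
    then have "shift (\<lambda>i. y (i + int k)) \<in> X"
      using img by blast
    then show ?case
      by (simp add: shift_def algebra_simps)
  qed (use that in simp)
  have backward: "(\<lambda>i. y (i - int k)) \<in> X" if "y \<in> X" for y k
  proof (induction k)
    case (Suc k)
    then obtain z where z: "z \<in> X" "(\<lambda>i. y (i - int k)) = shift z"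
      using img by blast
    have "z i = y (i - int (Suc k))" for i
      using fun_cong[OF z(2), of "i - 1"] by (simp add: shift_def algebra_simps)
    then have "z = (\<lambda>i. y (i - int (Suc k)))"
      by (rule ext)
    then show ?case
      using z(1) by simp
  qed (use that in simp)
  show ?thesis
    using forward[OF assms(2), of "nat m"] backward[OF assms(2), of "nat (- m)"]
    by (cases "m \<ge> 0") simp_all
qed

lemma map_upto_eq_iff:
  "map x [m + 1 - int (length w)..m] = w \<longleftrightarrow>
    (\<forall>k<length w. x (m + 1 - int (length w) + int k) = w ! k)"
  unfolding list_eq_iff_nth_eq by simp

text \<open>Shift invariance lets an occurrence be moved so that it ends at any prescribed
  coordinate \<open>m\<close>. Below, \<open>m = 0\<close> is used for words ending a past and
  \<open>m = 1\<close> for words \<open>b @ [\<sigma>]\<close> with \<open>\<sigma>\<close> as the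
  next symbol.\<close>

lemma admissible_iff:
  assumes "subshift A X"
  shows "admissible X w \<longleftrightarrow> (\<exists>x\<in>X. map x [m + 1 - int (length w)..m] = w)"
proof
  assume "admissible X w"
  then obtain x i where x: "x \<in> X" "\<forall>k<length w. x (i + int k) = w ! k"
    unfolding admissible_def by blast
  define y where "y = (\<lambda>j. x (j + (i - (m + 1 - int (length w)))))"
  have "y \<in> X"
    unfolding y_def using assms x(1) by (rule subshift_translate)
  moreover have "map y [m + 1 - int (length w)..m] = w"
    unfolding map_upto_eq_iff using x(2) by (simp add: y_def algebra_simps)
  ultimately show "\<exists>x\<in>X. map x [m + 1 - int (length w)..m] = w"
    by blast
next
  assume "\<exists>x\<in>X. map x [m + 1 - int (length w)..m] = w"
  then show "admissible X w"
    unfolding admissible_def map_upto_eq_iff by blast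
qed

lemma map_upto_snoc_iff:
  "map x [1 - int (length b)..1] = b @ [\<sigma>] \<longleftrightarrow> map x [1 - int (length b)..0] = b \<and> x 1 = \<sigma>"
proof -
  have "[1 - int (length b)..1] = [1 - int (length b)..0] @ [1]"
    using upto_rec2[of "1 - int (length b)" 1] by simp
  then show ?thesis
    by simp
qed

lemma map_upto_append:
  fixes x :: "int \<Rightarrow> 'a"
  assumes "n \<le> N"
  shows "map x [1 - int N..0] = map x [1 - int N..- int n] @ map x [1 - int n..0]"
proof -
  have "[1 - int N..0] = [1 - int N..- int n] @ [1 - int n..0]"
    using assms upto_split1[of "1 - int N" "1 - int n" 0] by (cases "n = 0") auto
  then show ?thesis
    by simp
qed

section \<open>One-sided sequences and their next symbols\<close>

lemma subshift_subset: "subshift A X \<Longrightarrow> X \<subseteq> UNIV \<rightarrow>\<^sub>E A"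
  unfolding subshift_def using closedin_subset[of "seq_topology A UNIV" X] by simp

lemma proj_subset: "subshift A X \<Longrightarrow> proj X J \<subseteq> J \<rightarrow>\<^sub>E A"
  using subshift_subset[of A X] by (auto simp: proj_def PiE_iff)

text \<open>Brings the one-letter context into the form of a preimage of
  \<open>proj X {..1}\<close>, from which its closedness is derived later. A point of X extending
  the past carries \<open>\<sigma>\<close> at coordinate 1, which supplies the block.\<close>

lemma next_symbol_iff: "[\<sigma>] \<in> future_context X 1 x \<longleftrightarrow> append_word x [\<sigma>] \<in> proj X {..1}"
proof -
  have "[\<sigma>] \<in> blocks X 1" if "append_word x [\<sigma>] \<in> proj X {..1}"
  proof -
    from that obtain z where z: "z \<in> X" "append_word x [\<sigma>] = restrict z {..1}"
      by (auto simp: proj_def)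
    have "z 1 = \<sigma>"
      using fun_cong[OF z(2), of 1] by (simp add: append_word_def)
    then show ?thesis
      using z(1) by (auto simp: blocks_def)
  qed
  then show ?thesis
    by (auto simp: future_context_def)
qed

lemma append_word_restrict:
  assumes "z \<in> {..1} \<rightarrow>\<^sub>E A"
  shows "append_word (restrict z {..0}) [z 1] = z"
proof
  fix i :: int
  consider "i \<le> 0" | "i = 1" | "i > 1"
    by linarith
  then show "append_word (restrict z {..0}) [z 1] i = z i"
    using PiE_arb[OF assms, of i] by cases (simp_all add: append_word_def)
qed

lemma next_symbols_subset:
  assumes "subshift A X"
  shows "next_symbols X x \<subseteq> A"
proof
  fix \<sigma> assume "\<sigma> \<in> next_symbols X x"
  then have "append_word x [\<sigma>] \<in> {..1} \<rightarrow>\<^sub>E A"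
    using next_symbol_iff[of \<sigma> X x] proj_subset[OF assms] by auto
  then have "append_word x [\<sigma>] 1 \<in> A"
    by (rule PiE_mem) simp
  then show "\<sigma> \<in> A"
    by (simp add: append_word_def)
qed

lemma next_symbols_nonempty:
  assumes "subshift A X" "x \<in> proj X {..0}"
  shows "next_symbols X x \<noteq> {}"
proof -
  obtain z where z: "z \<in> X" "x = restrict z {..0}"
    using assms(2) by (auto simp: proj_def)
  have "restrict z {..1} \<in> proj X {..1}"
    using z by (auto simp: proj_def)
  moreover have "restrict (restrict z {..1}) {..0} = x"
    by (simp add: z Int_absorb1)
  ultimately have "append_word x [z 1] \<in> proj X {..1}"
    using append_word_restrict[of "restrict z {..1}" A] proj_subset[OF assms(1), of "{..1}"]
    by auto
  then show ?thesis
    using next_symbol_iff[of "z 1" X x] by blast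
qed

section \<open>Left-infinite contexts as cylinders of pasts\<close>

lemma shift_append_word:
  "(shift ^^ length w) (append_word x (w @ b)) =
    append_word ((shift ^^ length w) (append_word x w)) b"
proof
  fix i
  have "nat (i + int (length w) - 1) - length w = nat (i - 1)" if "i > 0"
    using that by linarith
  then show "(shift ^^ length w) (append_word x (w @ b)) i =
    append_word ((shift ^^ length w) (append_word x w)) b i"
    by (auto simp: shift_funpow append_word_def nth_append)
qed

text \<open>Translation by \<open>length w\<close> moves the copy of \<open>w\<close> to the end of
  the index set; conversely, deleting \<open>w\<close> from the end of a past recovers the
  context.\<close>

lemma past_context_inf_image:
  assumes "subshift A X"
  shows "(\<lambda>x. (shift ^^ length w) (append_word x w)) ` past_context_inf A X w =
    {y \<in> proj X {..0}. map y [1 - int (length w)..0] = w}" (is "?L = ?R")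
proof
  show "?L \<subseteq> ?R"
    using map_upto_eq_iff[of _ 0 w]
    by (auto simp: past_context_inf_def shift_funpow append_word_def nat_add_distrib)
next
  show "?R \<subseteq> ?L"
  proof
    fix y assume y: "y \<in> ?R"
    define x where "x = restrict (\<lambda>i. y (i - int (length w))) {..0}"
    have yA: "y \<in> {..0} \<rightarrow>\<^sub>E A"
      using y proj_subset[OF assms] by blast
    have w: "y (1 - int (length w) + int k) = w ! k" if "k < length w" for k
      using y map_upto_eq_iff[of y 0 w] that by auto
    have xw: "(shift ^^ length w) (append_word x w) = y"
    proof
      fix i
      have "w ! nat (i + int (length w) - 1) = y i" if "i \<le> 0" "i + int (length w) > 0"
        using w[of "nat (i + int (length w) - 1)"] that by simp
      \<comment> \<open>Equality as functions also has to be checked off the index set, where both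
        sides take the default value.\<close>
      moreover have "y i = undefined" if "i > 0"
        using that by (intro PiE_arb[OF yA]) simp
      ultimately show "(shift ^^ length w) (append_word x w) i = y i"
        by (auto simp: shift_funpow append_word_def x_def)
    qed
    moreover have "x \<in> {..0} \<rightarrow>\<^sub>E A"
      using yA by (auto simp: x_def PiE_iff)
    ultimately have "x \<in> past_context_inf A X w"
      using y by (simp add: past_context_inf_def)
    then show "y \<in> ?L"
      using xw by blast
  qed
qed

text \<open>Reindexing along the previous image turns property (D) into a statement about cylinders
  of pasts.\<close>

lemma omega_plus_eq:
  assumes "subshift A X"
  shows "omega_plus A X n w =
    (\<Inter>y\<in>{y \<in> proj X {..0}. map y [1 - int (length w)..0] = w}. future_context X n y)"
  unfolding past_context_inf_image[OF assms, symmetric] omega_plus_def future_context_def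
  by (simp add: shift_append_word)

section \<open>The topology of one-sided sequences\<close>

text \<open>A basic open set of the product constrains finitely many coordinates, hence none below
  some \<open>l\<close>, so agreement on a window reaching back to \<open>l\<close> suffices.
  Allowing every \<open>N\<close> above \<open>n\<close> lets the window be lengthened to contain a
  given word.\<close>

lemma open_seq_neighbourhood:
  assumes "openin (seq_topology A {..m}) U" "x \<in> U"
  obtains n :: nat where "\<And>N y. \<lbrakk>n \<le> N; y \<in> {..m} \<rightarrow>\<^sub>E A; map y [m + 1 - int N..m] = map x [m + 1 - int N..m]\<rbrakk> \<Longrightarrow> y \<in> U"
proof -
  obtain V where V: "finite {i \<in> {..m}. V i \<noteq> A}" "x \<in> Pi\<^sub>E {..m} V" "Pi\<^sub>E {..m} V \<subseteq> U"
    using assms unfolding openin_product_topology_alt by force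
  obtain l where l: "\<And>i. i \<le> m \<Longrightarrow> V i \<noteq> A \<Longrightarrow> l \<le> i"
    using bdd_below_finite[OF V(1)] by (auto simp: bdd_below_def)
  show thesis
  proof (rule that[of "nat (m + 1 - l)"])
    fix N y
    assume N: "nat (m + 1 - l) \<le> N" "y \<in> {..m} \<rightarrow>\<^sub>E A"
      and eq: "map y [m + 1 - int N..m] = map x [m + 1 - int N..m]"
    have "y i \<in> V i" if "i \<le> m" for i
    proof (cases "V i = A")
      case True
      then show ?thesis
        using PiE_mem[OF N(2)] that by simp
    next
      case False
      then have "i \<in> set [m + 1 - int N..m]"
        using l[of i] N(1) that by auto
      then have "y i = x i"
        using eq unfolding map_eq_conv by blast
      then show ?thesis
        using PiE_mem[OF V(2)] that by simp
    qed
    then have "y \<in> Pi\<^sub>E {..m} V"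
      using N(2) by (auto simp: PiE_iff)
    then show "y \<in> U"
      using V(3) by blast
  qed
qed

lemma openin_cylinder:
  assumes "j \<le> m"
  shows "openin (seq_topology A {..m}) {y \<in> {..m} \<rightarrow>\<^sub>E A. map y [i..j] = w}"
  unfolding openin_product_topology_alt
proof
  fix y assume y: "y \<in> {y \<in> {..m} \<rightarrow>\<^sub>E A. map y [i..j] = w}"
  define U where "U k = (if k \<in> {i..j} then {y k} else A)" for k
  have "finite {k \<in> {..m}. U k \<noteq> A}"
    by (rule finite_subset[of _ "{i..j}"]) (auto simp: U_def)
  moreover have "y \<in> Pi\<^sub>E {..m} U" "\<forall>k\<in>{..m}. U k \<subseteq> A"
    using y by (auto simp: U_def)
  moreover have "z \<in> {..m} \<rightarrow>\<^sub>E A" "map z [i..j] = w" if "z \<in> Pi\<^sub>E {..m} U" for z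
  proof -
    show "z \<in> {..m} \<rightarrow>\<^sub>E A"
      using that \<open>\<forall>k\<in>{..m}. U k \<subseteq> A\<close> by (auto simp: PiE_iff)
    have "z k = y k" if "k \<in> {i..j}" for k
      using PiE_mem[OF \<open>z \<in> Pi\<^sub>E {..m} U\<close>, of k] that assms by (auto simp: U_def)
    then have "map z [i..j] = map y [i..j]"
      by simp
    also have "\<dots> = w"
      using y by simp
    finally show "map z [i..j] = w" .
  qed
  then have "Pi\<^sub>E {..m} U \<subseteq> {y \<in> {..m} \<rightarrow>\<^sub>E A. map y [i..j] = w}"
    by blast
  ultimately show "\<exists>U. finite {k \<in> {..m}. U k \<noteq> topspace (discrete_topology A)} \<and>
      (\<forall>k\<in>{..m}. openin (discrete_topology A) (U k)) \<and> y \<in> Pi\<^sub>E {..m} U \<and>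
      Pi\<^sub>E {..m} U \<subseteq> {y \<in> {..m} \<rightarrow>\<^sub>E A. map y [i..j] = w}"
    by (intro exI[of _ U]) simp
qed

text \<open>Finiteness of the alphabet makes X compact, and its image under the continuous
  restriction map is compact in a Hausdorff space.\<close>

lemma closedin_proj:
  assumes "finite A" "subshift A X"
  shows "closedin (seq_topology A J) (proj X J)"
proof (rule compactin_imp_closedin)
  show "Hausdorff_space (seq_topology A J)"
    by (simp add: Hausdorff_space_product_topology)
  have "compact_space (seq_topology A UNIV)"
    using assms(1) by (simp add: compact_space_product_topology compact_space_discrete_topology)
  then have "compactin (seq_topology A UNIV) X"
    using assms(2) by (simp add: subshift_def closedin_compact_space)
  moreover have "continuous_map (seq_topology A UNIV) (seq_topology A J) (\<lambda>x. restrict x J)"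
    using continuous_map_product_coordinates[of _ UNIV "\<lambda>_. discrete_topology A"]
    by (auto simp: continuous_map_componentwise)
  ultimately show "compactin (seq_topology A J) (proj X J)"
    unfolding proj_def by (rule image_compactin)
qed

lemma topspace_proj_topology: "subshift A X \<Longrightarrow> topspace (proj_topology A X J) = proj X J"
  using proj_subset[of A X J] by (simp add: Int_absorb1)

lemma continuous_map_append_symbol:
  assumes "\<sigma> \<in> A"
  shows "continuous_map (seq_topology A {..0}) (seq_topology A {..1}) (\<lambda>x. append_word x [\<sigma>])"
  unfolding continuous_map_componentwise
proof (intro conjI ballI)
  show "(\<lambda>x. append_word x [\<sigma>]) ` topspace (seq_topology A {..0}) \<subseteq> extensional {..1}"
    by (rule image_subsetI) (simp add: append_word_def extensional_def)
  fix i :: int assume "i \<in> {..1}"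
  then show "continuous_map (seq_topology A {..0}) (discrete_topology A) (\<lambda>x. append_word x [\<sigma>] i)"
    using assms continuous_map_product_coordinates[of i "{..0}" "\<lambda>_. discrete_topology A"]
    by (cases "i \<le> 0") (auto simp: append_word_def)
qed

text \<open>For \<open>\<sigma>\<close> in the alphabet the set is the preimage of the closed set
  \<open>proj X {..1}\<close> under the continuous map appending \<open>\<sigma>\<close>; for other
  symbols it is empty.\<close>

lemma closedin_next_symbol:
  assumes "finite A" "subshift A X"
  shows "closedin (proj_topology A X {..0}) {x \<in> proj X {..0}. \<sigma> \<in> next_symbols X x}"
proof (cases "\<sigma> \<in> A")
  case True
  have "continuous_map (proj_topology A X {..0}) (seq_topology A {..1}) (\<lambda>x. append_word x [\<sigma>])"
    using continuous_map_append_symbol[OF True] by (rule continuous_map_from_subtopology)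
  then have "closedin (proj_topology A X {..0})
      {x \<in> topspace (proj_topology A X {..0}). append_word x [\<sigma>] \<in> proj X {..1}}"
    using closedin_proj[OF assms] by (rule closedin_continuous_map_preimage)
  then show ?thesis
    unfolding topspace_proj_topology[OF assms(2)] mem_Collect_eq next_symbol_iff .
next
  case False
  then have "{x \<in> proj X {..0}. \<sigma> \<in> next_symbols X x} = {}"
    using next_symbols_subset[OF assms(2)] by blast
  then show ?thesis
    by (simp only: closedin_empty)
qed

text \<open>Frontiers of closed sets are nowhere dense: if an open \<open>W\<close> meets the
  frontier of a closed \<open>S\<close>, then \<open>W - S\<close> is nonempty, open and misses it.
  Shrinking \<open>W\<close> once for each index avoids all finitely many frontiers.\<close>

lemma dense_topspace_minus_frontiers:
  assumes "finite I" "\<And>i. i \<in> I \<Longrightarrow> closedin T (F i)"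
  shows "T closure_of (topspace T - (\<Union>i\<in>I. T frontier_of F i)) = topspace T"
proof -
  have avoid: "\<exists>V. openin T V \<and> V \<noteq> {} \<and> V \<subseteq> W \<and> V \<inter> T frontier_of S = {}"
    if "openin T W" "W \<noteq> {}" "closedin T S" for W S
  proof (cases "W \<inter> T frontier_of S = {}")
    case False
    then have "W - S \<noteq> {}"
      using frontier_of_openin_straddle_Int[OF that(1)] by blast
    moreover have "openin T (W - S)"
      using that by (simp add: openin_diff)
    moreover have "T frontier_of S \<subseteq> S"
      using that(3) by (rule frontier_of_subset_closedin)
    ultimately show ?thesis
      by (intro exI[of _ "W - S"]) auto
  qed (use that in blast)
  have avoid_all: "\<exists>V. openin T V \<and> V \<noteq> {} \<and> V \<subseteq> W \<and> V \<inter> (\<Union>i\<in>I. T frontier_of F i) = {}"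
    if "openin T W" "W \<noteq> {}" for W
    using assms that
  proof (induction I arbitrary: W rule: finite_induct)
    case (insert i I)
    obtain V where V: "openin T V" "V \<noteq> {}" "V \<subseteq> W" "V \<inter> (\<Union>i\<in>I. T frontier_of F i) = {}"
      using insert by (metis insertCI)
    moreover obtain U where "openin T U" "U \<noteq> {}" "U \<subseteq> V" "U \<inter> T frontier_of F i = {}"
      using avoid[OF V(1,2)] insert.prems(1) by (metis insertI1)
    ultimately show ?case
      by (intro exI[of _ U]) auto
  qed auto
  have "(topspace T - (\<Union>i\<in>I. T frontier_of F i)) \<inter> W \<noteq> {}" if W: "openin T W" "W \<noteq> {}" for W
  proof -
    obtain V where "openin T V" "V \<noteq> {}" "V \<subseteq> W" "V \<inter> (\<Union>i\<in>I. T frontier_of F i) = {}"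
      using avoid_all[OF W] by blast
    then show ?thesis
      using openin_subset[of T V] by blast
  qed
  then show ?thesis
    by (simp add: dense_intersects_open)
qed


section \<open>From a g-function to property (D)\<close>

lemma g_function_imp_property_D:
  assumes "finite A" "subshift A X" "residually_defined_g_function A X D g"
  shows "property_D A X"
  unfolding property_D_def
proof (intro allI impI)
  fix b \<sigma> assume adm: "admissible X (b @ [\<sigma>])"
  define P where "P = proj_topology A X {..0}"
  have topP: "topspace P = proj X {..0}"
    unfolding P_def using assms(2) by (rule topspace_proj_topology)
  have res: "residual_in P D"
    and cont: "continuous_map (prod_topology (subtopology P D) (discrete_topology A))
        (top_of_set {0..1}) (\<lambda>(x, \<sigma>). g x \<sigma>)"
    and zero: "\<And>x \<sigma>. x \<in> D \<Longrightarrow> \<sigma> \<in> A - next_symbols X x \<Longrightarrow> g x \<sigma> = 0"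
    and clos: "proj X {..1} = seq_topology A {..1} closure_of
         {append_word x [\<alpha>] | x \<alpha>. x \<in> D \<and> \<alpha> \<in> next_symbols X x \<and> g x \<alpha> > 0}"
    using assms(3) unfolding residually_defined_g_function_def P_def by blast+
  have D: "D \<subseteq> proj X {..0}"
    using res topP by (simp add: residual_in_def)
  have dense: "P closure_of D = topspace P"
    using res closure_of_mono closure_of_subset_topspace unfolding residual_in_def
    by (metis subset_antisym)
  obtain z where z: "z \<in> X" "map z [1 - int (length b)..1] = b @ [\<sigma>]"
    using adm admissible_iff[OF assms(2), of "b @ [\<sigma>]" 1] by auto
  \<comment> \<open>Condition (iii) writes the one-step extensions as a closure, so the open set
    \<open>W\<close> around \<open>z\<close> contains some \<open>append_word x [\<alpha>]\<close>
    of positive weight; membership in \<open>W\<close> then forces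
    \<open>\<alpha> = \<sigma>\<close> and makes \<open>x\<close> end in \<open>b\<close>.\<close>
  define W where "W = {y \<in> {..1} \<rightarrow>\<^sub>E A. map y [1 - int (length b)..1] = b @ [\<sigma>]}"
  have openW: "openin (seq_topology A {..1}) W"
    unfolding W_def by (rule openin_cylinder) simp
  have "restrict z {..1} \<in> proj X {..1}"
    using z(1) by (auto simp: proj_def)
  moreover from this have "restrict z {..1} \<in> {..1} \<rightarrow>\<^sub>E A"
    using proj_subset[OF assms(2)] by blast
  then have "restrict z {..1} \<in> W"
    by (simp add: W_def z(2)[symmetric])
  ultimately obtain x \<alpha> where x: "x \<in> D" "\<alpha> \<in> next_symbols X x" "g x \<alpha> > 0"
    and xW: "append_word x [\<alpha>] \<in> W"
    using openW unfolding clos in_closure_of by blast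
  have "map (append_word x [\<alpha>]) [1 - int (length b)..0] = b" "append_word x [\<alpha>] 1 = \<sigma>"
    using xW unfolding W_def map_upto_snoc_iff by auto
  moreover have "map (append_word x [\<alpha>]) [1 - int (length b)..0] = map x [1 - int (length b)..0]"
    by (simp add: append_word_def)
  ultimately have xb: "map x [1 - int (length b)..0] = b"
    by metis
  have \<alpha>: "\<alpha> = \<sigma>"
    using \<open>append_word x [\<alpha>] 1 = \<sigma>\<close> by (simp add: append_word_def)
  have "\<sigma> \<in> A"
    using x(2) \<alpha> next_symbols_subset[OF assms(2)] by blast
  then have "continuous_map (subtopology P D) (prod_topology (subtopology P D) (discrete_topology A))
      (\<lambda>x. (x, \<sigma>))"
    by (simp add: continuous_map_pairwise o_def)
  from continuous_map_compose[OF this cont]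
  have "continuous_map (subtopology P D) euclideanreal (\<lambda>x. g x \<sigma>)"
    by (auto simp: o_def continuous_map_in_subtopology)
  then have "openin (subtopology P D) {x \<in> topspace (subtopology P D). g x \<sigma> \<in> {0<..}}"
    by (rule openin_continuous_map_preimage) simp
  moreover have "{x \<in> topspace (subtopology P D). g x \<sigma> \<in> {0<..}} = {x \<in> D. g x \<sigma> > 0}"
    using D topP by auto
  ultimately obtain V where V: "openin P V" "{x \<in> D. g x \<sigma> > 0} = V \<inter> D"
    by (auto simp: openin_subtopology)
  \<comment> \<open>The cylinder lemma speaks about the full sequence space, so \<open>V\<close> is
    lifted from the pasts of X to an open set \<open>U\<close> there.\<close>
  then obtain U where U: "openin (seq_topology A {..0}) U" "V = U \<inter> proj X {..0}"
    by (auto simp: P_def openin_subtopology)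
  have "x \<in> U"
    using x \<alpha> V U by blast
  with U(1) obtain n :: nat where n: "\<And>N y. \<lbrakk>n \<le> N; y \<in> {..0} \<rightarrow>\<^sub>E A;
      map y [0 + 1 - int N..0] = map x [0 + 1 - int N..0]\<rbrakk> \<Longrightarrow> y \<in> U"
    by (rule open_seq_neighbourhood) (rule that)
  \<comment> \<open>\<open>N\<close> is at least \<open>n\<close>, so that pasts agreeing with
    \<open>x\<close> on the last \<open>N\<close> letters lie in \<open>U\<close>, and at least
    \<open>length b\<close>, so that these letters end in \<open>b\<close>; \<open>a\<close> is what
    precedes \<open>b\<close> among them.\<close>
  define N where "N = max n (length b)"
  define a where "a = map x [1 - int N..- int (length b)]"
  have ab: "a @ b = map x [1 - int N..0]"
    using map_upto_append[of "length b" N x] by (simp add: a_def xb N_def)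
  then have len: "length (a @ b) = N"
    by simp
  have "a \<in> past_context X b"
  proof -
    obtain y where y: "y \<in> X" "x = restrict y {..0}"
      using x(1) D by (auto simp: proj_def)
    then have "map y [1 - int N..0] = a @ b"
      by (simp add: ab)
    then show ?thesis
      using y(1) admissible_iff[OF assms(2), of "a @ b" 0] len by (auto simp: past_context_def)
  qed
  moreover have "[\<sigma>] \<in> omega_plus A X 1 (a @ b)"
    unfolding omega_plus_eq[OF assms(2)] len
  proof
    fix y assume "y \<in> {y \<in> proj X {..0}. map y [1 - int N..0] = a @ b}"
    then have y: "y \<in> proj X {..0}" "map y [1 - int N..0] = a @ b"
      by auto
    have "y \<in> U"
      using n[of N y] y proj_subset[OF assms(2), of "{..0}"] by (auto simp: N_def ab)
    \<comment> \<open>Since \<open>V\<close> is open, a point of \<open>V\<close> in the closure of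
      \<open>D\<close> is a limit of points of \<open>V \<inter> D\<close>. There \<open>g\<close>
      is positive at \<open>\<sigma>\<close>, so (i) makes \<open>\<sigma>\<close> a next symbol,
      and this closed condition passes to \<open>y\<close>.\<close>
    then have "y \<in> V \<inter> P closure_of D"
      using y(1) by (simp add: dense topP U(2))
    then have "y \<in> P closure_of (V \<inter> D)"
      using openin_Int_closure_of_subset[OF V(1)] by blast
    moreover have "V \<inter> D \<subseteq> {x \<in> proj X {..0}. \<sigma> \<in> next_symbols X x}"
      using zero D \<open>\<sigma> \<in> A\<close> V(2)[symmetric] by force
    ultimately have "y \<in> {x \<in> proj X {..0}. \<sigma> \<in> next_symbols X x}"
      using closure_of_minimal[OF _ closedin_next_symbol[OF assms(1,2)]] unfolding P_def by blast
    then show "[\<sigma>] \<in> future_context X 1 y"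
      by simp
  qed
  ultimately show "\<exists>a\<in>past_context X b. [\<sigma>] \<in> omega_plus A X 1 (a @ b)"
    by blast
qed

section \<open>From property (D) to a g-function\<close>

lemma continuous_map_locally_constant:
  assumes "\<And>x. x \<in> topspace T \<Longrightarrow> f x \<in> topspace Z"
    and "\<And>x. x \<in> topspace T \<Longrightarrow> \<exists>N. openin T N \<and> x \<in> N \<and> (\<forall>y\<in>N. f y = f x)"
  shows "continuous_map T Z f"
  unfolding continuous_map_def
proof (intro conjI allI impI)
  fix U
  show "openin T {x \<in> topspace T. f x \<in> U}"
  proof (subst openin_subopen, intro ballI)
    fix x assume x: "x \<in> {x \<in> topspace T. f x \<in> U}"
    then obtain N where N: "openin T N" "x \<in> N" "\<forall>y\<in>N. f y = f x"
      using assms(2)[of x] by blast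
    then have "N \<subseteq> {x \<in> topspace T. f x \<in> U}"
      using x openin_subset[OF N(1)] by fastforce
    then show "\<exists>N. openin T N \<and> x \<in> N \<and> N \<subseteq> {x \<in> topspace T. f x \<in> U}"
      using N by blast
  qed
qed (use assms(1) in auto)

lemma continuous_map_prod_discrete:
  assumes "\<And>\<sigma>. \<sigma> \<in> A \<Longrightarrow> continuous_map T Z (\<lambda>x. h x \<sigma>)"
  shows "continuous_map (prod_topology T (discrete_topology A)) Z (\<lambda>(x, \<sigma>). h x \<sigma>)"
  unfolding continuous_map_def
proof (intro conjI allI impI)
  show "(\<lambda>(x, \<sigma>). h x \<sigma>) \<in> topspace (prod_topology T (discrete_topology A)) \<rightarrow> topspace Z"
  proof
    fix p assume "p \<in> topspace (prod_topology T (discrete_topology A))"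
    then show "(case p of (x, \<sigma>) \<Rightarrow> h x \<sigma>) \<in> topspace Z"
      using continuous_map_funspace[OF assms, of "snd p"] by (cases p) auto
  qed
  fix U assume U: "openin Z U"
  have "{p \<in> topspace (prod_topology T (discrete_topology A)). (case p of (x, \<sigma>) \<Rightarrow> h x \<sigma>) \<in> U} =
      (\<Union>\<sigma>\<in>A. {x \<in> topspace T. h x \<sigma> \<in> U} \<times> {\<sigma>})"
    by auto
  moreover have "openin (prod_topology T (discrete_topology A)) ({x \<in> topspace T. h x \<sigma> \<in> U} \<times> {\<sigma>})"
    if "\<sigma> \<in> A" for \<sigma>
    using openin_continuous_map_preimage[OF assms[OF that] U] that
    by (simp add: openin_prod_Times_iff)
  ultimately show "openin (prod_topology T (discrete_topology A))
      {p \<in> topspace (prod_topology T (discrete_topology A)). (case p of (x, \<sigma>) \<Rightarrow> h x \<sigma>) \<in> U}"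
    by auto
qed

text \<open>Off the frontier of a closed set, a point lies either in the interior or in the
  complement. Both are open, and finitely many such choices intersect in a neighbourhood.\<close>

lemma locally_constant_off_frontiers:
  assumes "finite I" "\<And>i. i \<in> I \<Longrightarrow> closedin T (F i)"
    and "x \<in> topspace T - (\<Union>i\<in>I. T frontier_of F i)"
  obtains N where "openin T N" "x \<in> N" "\<And>y. y \<in> N \<Longrightarrow> {i \<in> I. y \<in> F i} = {i \<in> I. x \<in> F i}"
\<comment> \<open>An empty intersection would be the whole type rather than an open set of
  \<open>T\<close>.\<close>
proof (cases "I = {}")
  case True
  then show ?thesis
    using that[of "topspace T"] assms(3) by simp
next
  case False
  define H where "H i = (if x \<in> F i then T interior_of F i else topspace T - F i)" for i
  have "openin T (\<Inter>i\<in>I. H i)"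
    using assms(1,2) False by (intro openin_INT2) (auto simp: H_def openin_diff)
  moreover have "x \<in> T interior_of F i" if "i \<in> I" "x \<in> F i" for i
    using assms(2)[OF that(1)] assms(3) that closure_of_subset[of "F i" T] closedin_subset
    by (fastforce simp: frontier_of_def)
  then have "x \<in> (\<Inter>i\<in>I. H i)"
    using assms(3) by (auto simp: H_def)
  moreover have "y \<in> F i \<longleftrightarrow> x \<in> F i" if "y \<in> (\<Inter>i\<in>I. H i)" "i \<in> I" for y i
  proof -
    have "y \<in> H i"
      using that by blast
    then show ?thesis
      using interior_of_subset[of T "F i"] by (auto simp: H_def split: if_splits)
  qed
  then have "{i \<in> I. y \<in> F i} = {i \<in> I. x \<in> F i}" if "y \<in> (\<Inter>i\<in>I. H i)" for y
    using that by blast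
  ultimately show ?thesis
    by (rule that)
qed


lemma property_D_imp_g_function:
  assumes "finite A" "subshift A X" "property_D A X"
  shows "\<exists>D g. residually_defined_g_function A X D g"
proof -
  define P where "P = proj_topology A X {..0}"
  have topP: "topspace P = proj X {..0}"
    unfolding P_def using assms(2) by (rule topspace_proj_topology)
  define Y where "Y = product_topology (\<lambda>_::'a. euclideanreal) A"
  define F where "F \<sigma> = {x \<in> proj X {..0}. \<sigma> \<in> next_symbols X x}" for \<sigma>
  \<comment> \<open>The restriction to \<open>A\<close> makes \<open>f x\<close> a point of the
    product space \<open>Y\<close>, matching \<open>restrict (g x) A\<close> in condition
    (ii).\<close>
  define f where "f x = (\<lambda>\<sigma>\<in>A. if \<sigma> \<in> next_symbols X x then 1 / real (card (next_symbols X x)) else 0)" for x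
  define E where "E = topspace P - (\<Union>\<sigma>\<in>A. P frontier_of F \<sigma>)"
  have closedF: "closedin P (F \<sigma>)" for \<sigma>
    unfolding P_def F_def using assms(1,2) by (rule closedin_next_symbol)
  have fin: "finite (next_symbols X x)" for x
    using next_symbols_subset[OF assms(2)] assms(1) by (rule finite_subset)
  have card_pos: "card (next_symbols X x) > 0" if "x \<in> proj X {..0}" for x
    using next_symbols_nonempty[OF assms(2) that] fin[of x] unfolding card_gt_0_iff by blast
  have E_sub: "E \<subseteq> proj X {..0}"
    using topP by (auto simp: E_def)
  have openE: "openin P E"
    unfolding E_def
    by (intro openin_diff closedin_Union) (auto simp: assms(1) closedin_frontier_of)
  have denseE: "P closure_of E = topspace P"
    unfolding E_def using assms(1) closedF by (rule dense_topspace_minus_frontiers)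
  have contf: "continuous_map (subtopology P E) Y f"
  proof (rule continuous_map_locally_constant)
    fix x assume "x \<in> topspace (subtopology P E)"
    then have x: "x \<in> E"
      by simp
    show "f x \<in> topspace Y"
      by (simp add: Y_def f_def)
    obtain N where N: "openin P N" "x \<in> N" "\<And>y. y \<in> N \<Longrightarrow> {\<sigma> \<in> A. y \<in> F \<sigma>} = {\<sigma> \<in> A. x \<in> F \<sigma>}"
      using locally_constant_off_frontiers[of A P F x] assms(1) closedF x unfolding E_def by blast
    have next_eq: "next_symbols X y = {\<sigma> \<in> A. y \<in> F \<sigma>}" if "y \<in> E" for y
      using that E_sub next_symbols_subset[OF assms(2), of y] unfolding F_def by blast
    have "f y = f x" if "y \<in> N \<inter> E" for y
    proof -
      have "next_symbols X y = next_symbols X x"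
        using next_eq[of y] next_eq[OF x] N(3)[of y] that by simp
      then show ?thesis
        by (simp only: f_def)
    qed
    moreover have "openin (subtopology P E) (N \<inter> E)"
      using N(1) by (rule openin_subtopology_Int)
    ultimately show "\<exists>N. openin (subtopology P E) N \<and> x \<in> N \<and> (\<forall>y\<in>N. f y = f x)"
      using N(2) x by blast
  qed
  \<comment> \<open>Each point is tested separately, with its own extension \<open>h\<close>. Taking
    every point that passes is what yields (ii).\<close>
  define D where "D = {y \<in> proj X {..0}.
    \<exists>h. continuous_map (subtopology P (insert y E)) Y h \<and> (\<forall>x\<in>E. h x = f x)}"
  have ED: "E \<subseteq> D"
    using contf E_sub by (auto simp: D_def insert_absorb)
  have D_sub: "D \<subseteq> proj X {..0}"
    by (auto simp: D_def)
  \<comment> \<open>The separate extensions fit together into one continuous map because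
    \<open>E\<close> is dense and \<open>Y\<close> is regular.\<close>
  obtain G where G: "continuous_map (subtopology P D) Y G" and Gf: "\<And>x. x \<in> E \<Longrightarrow> G x = f x"
  proof (rule continuous_map_extension_pointwise[of Y E D P f])
    show "regular_space Y"
      by (simp add: Y_def regular_space_product_topology regular_space_euclidean)
    show "D \<subseteq> P closure_of E"
      using D_sub by (simp add: denseE topP)
  qed (use ED in \<open>auto simp: D_def\<close>)
  have topD: "topspace (subtopology P D) = D"
    using D_sub topP by auto
  have contG: "continuous_map (subtopology P D) euclideanreal (\<lambda>x. G x \<sigma>)" if "\<sigma> \<in> A" for \<sigma>
    using G that unfolding Y_def continuous_map_componentwise by blast
  \<comment> \<open>Closed conditions pass from the dense subset \<open>E\<close> to
    \<open>D\<close>. Range, vanishing and total mass of \<open>G\<close> are all obtained this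
    way.\<close>
  have extend: "D \<subseteq> C" if "closedin (subtopology P D) C" "E \<subseteq> C" for C
  proof -
    have "(subtopology P D) closure_of E = D"
      using ED D_sub topP by (simp add: closure_of_subtopology Int_absorb1 Int_absorb2 denseE)
    then show ?thesis
      using closure_of_minimal[OF that(2,1)] by simp
  qed
  have closed_pre: "closedin (subtopology P D) {x \<in> D. u x \<in> K}"
    if "continuous_map (subtopology P D) euclideanreal u" "closed K" for u :: "(int \<Rightarrow> 'a) \<Rightarrow> real" and K
    using closedin_continuous_map_preimage[OF that(1), of K] that(2) unfolding topD by simp
  have range: "G x \<sigma> \<in> {0..1}" if "x \<in> D" "\<sigma> \<in> A" for x \<sigma>
  proof -
    have "f x \<sigma> \<in> {0..1}" if "x \<in> E" for x
      using card_pos[of x] that E_sub \<open>\<sigma> \<in> A\<close> by (auto simp: f_def)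
    then have "D \<subseteq> {x \<in> D. G x \<sigma> \<in> {0..1}}"
      using ED Gf by (intro extend closed_pre contG that) auto
    then show ?thesis
      using that(1) by blast
  qed
  have zero: "G x \<sigma> = 0" if "x \<in> D" "\<sigma> \<in> A" "\<sigma> \<notin> next_symbols X x" for x \<sigma>
  proof -
    \<comment> \<open>The implication "no next symbol, hence weight zero" is recast as membership in
      a union of two closed sets.\<close>
    have "closedin (subtopology P D) (F \<sigma> \<inter> D \<union> {x \<in> D. G x \<sigma> \<in> {0}})"
      by (intro closedin_Un closed_pre contG that) (use closedF[of \<sigma>] in \<open>auto simp: closedin_subtopology\<close>)
    moreover have "f x \<sigma> = 0" if "x \<in> E" "x \<notin> F \<sigma>" for x
      using that E_sub \<open>\<sigma> \<in> A\<close> by (auto simp: f_def F_def)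
    then have "E \<subseteq> F \<sigma> \<inter> D \<union> {x \<in> D. G x \<sigma> \<in> {0}}"
      using ED Gf by auto
    ultimately have "D \<subseteq> F \<sigma> \<inter> D \<union> {x \<in> D. G x \<sigma> \<in> {0}}"
      by (rule extend)
    then show ?thesis
      using that unfolding F_def by blast
  qed
  \<comment> \<open>Replaces an index set varying with \<open>x\<close> by the fixed set
    \<open>A\<close>, so that the sum of the weights is continuous in \<open>x\<close>.\<close>
  have sum_next: "(\<Sum>\<sigma>\<in>next_symbols X x. u \<sigma>) = (\<Sum>\<sigma>\<in>A. u \<sigma>)"
    if "\<And>\<sigma>. \<sigma> \<in> A - next_symbols X x \<Longrightarrow> u \<sigma> = 0" for x and u :: "'a \<Rightarrow> real"
    by (intro sum.mono_neutral_left assms(1) next_symbols_subset[OF assms(2)]) (use that in blast)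
  have sum_one: "(\<Sum>\<sigma>\<in>A. G x \<sigma>) = 1" if "x \<in> D" for x
  proof -
    have "(\<Sum>\<sigma>\<in>A. f x \<sigma>) = 1" if "x \<in> E" for x
    proof -
      have "(\<Sum>\<sigma>\<in>A. f x \<sigma>) = (\<Sum>\<sigma>\<in>next_symbols X x. f x \<sigma>)"
        by (rule sum_next[symmetric]) (simp add: f_def)
      also have "\<dots> = (\<Sum>\<sigma>\<in>next_symbols X x. 1 / real (card (next_symbols X x)))"
        using next_symbols_subset[OF assms(2), of x] by (intro sum.cong) (auto simp: f_def)
      also have "\<dots> = 1"
        using card_pos[of x] that E_sub by auto
      finally show ?thesis .
    qed
    moreover have "continuous_map (subtopology P D) euclideanreal (\<lambda>x. \<Sum>\<sigma>\<in>A. G x \<sigma>)"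
      by (intro continuous_map_sum assms(1) contG)
    ultimately have "D \<subseteq> {x \<in> D. (\<Sum>\<sigma>\<in>A. G x \<sigma>) \<in> {1}}"
      using ED Gf by (intro extend closed_pre) auto
    then show ?thesis
      using that by blast
  qed
  let ?S = "{append_word x [\<alpha>] | x \<alpha>. x \<in> D \<and> \<alpha> \<in> next_symbols X x \<and> G x \<alpha> > 0}"
  have "residually_defined_g_function A X D G"
    unfolding residually_defined_g_function_def P_def[symmetric]
  proof (intro conjI ballI)
    show "residual_in P D"
      unfolding residual_in_def using D_sub topP ED open_imp_gdelta_in[OF openE] denseE by blast
    have "continuous_map (subtopology P D) (top_of_set {0..1}) (\<lambda>x. G x \<sigma>)" if "\<sigma> \<in> A" for \<sigma>
      using contG[OF that] range[OF _ that] by (auto simp: continuous_map_in_subtopology topD)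
    then show "continuous_map (prod_topology (subtopology P D) (discrete_topology A))
        (top_of_set {0..1}) (\<lambda>(x, \<sigma>). G x \<sigma>)"
      by (rule continuous_map_prod_discrete)
  next
    fix x assume x: "x \<in> D"
    show "(\<Sum>\<sigma>\<in>next_symbols X x. G x \<sigma>) = 1"
      using sum_next[of x "G x"] zero[OF x] sum_one[OF x] by simp
    show "G x \<sigma> = 0" if "\<sigma> \<in> A - next_symbols X x" for \<sigma>
      using zero[OF x] that by simp
  next
    fix y assume y: "y \<in> proj X {..0} - D"
    show "\<not> (\<exists>h. continuous_map (subtopology P (insert y D)) (product_topology (\<lambda>_. euclideanreal) A) h \<and>
               (\<forall>x\<in>D. h x = restrict (G x) A))"
    proof
      assume "\<exists>h. continuous_map (subtopology P (insert y D)) (product_topology (\<lambda>_. euclideanreal) A) h \<and>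
               (\<forall>x\<in>D. h x = restrict (G x) A)"
      then obtain h where h: "continuous_map (subtopology P (insert y D)) Y h"
          "\<And>x. x \<in> D \<Longrightarrow> h x = restrict (G x) A"
        unfolding Y_def by blast
      \<comment> \<open>A continuous extension of \<open>G\<close> to \<open>y\<close> restricts to
        one of \<open>f\<close> from \<open>E\<close>, so \<open>y\<close> would already belong to
        \<open>D\<close>.\<close>
      have "continuous_map (subtopology P (insert y E)) Y h"
        using h(1) by (rule continuous_map_from_subtopology_mono) (use ED in blast)
      moreover have "h x = f x" if "x \<in> E" for x
        using h(2)[of x] Gf[OF that] ED that by (auto simp: f_def)
      ultimately have "y \<in> D"
        using y unfolding D_def by blast
      then show False
        using y by blast
    qed
  next
    have "?S \<subseteq> proj X {..1}"
      by (auto simp: next_symbol_iff[unfolded One_nat_def])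
    then have "seq_topology A {..1} closure_of ?S \<subseteq> proj X {..1}"
      using closedin_proj[OF assms(1,2)] by (rule closure_of_minimal)
    moreover have "z \<in> seq_topology A {..1} closure_of ?S" if z: "z \<in> proj X {..1}" for z
      unfolding in_closure_of
    proof (intro conjI allI impI)
      show "z \<in> topspace (seq_topology A {..1})"
        using z proj_subset[OF assms(2)] by auto
      fix U assume "z \<in> U \<and> openin (seq_topology A {..1}) U"
      then obtain n :: nat where n: "\<And>N y. \<lbrakk>n \<le> N; y \<in> {..1} \<rightarrow>\<^sub>E A;
          map y [1 + 1 - int N..1] = map z [1 + 1 - int N..1]\<rbrakk> \<Longrightarrow> y \<in> U"
        using open_seq_neighbourhood[of A 1 U z] by metis
      define b where "b = map z [1 - int n..0]"
      have len: "length b = n"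
        by (simp add: b_def)
      obtain z' where z': "z' \<in> X" "z = restrict z' {..1}"
        using z by (auto simp: proj_def)
      then have "map z' [1 - int n..0] = b"
        by (simp add: b_def)
      then have "map z' [1 - int n..1] = b @ [z 1]"
        using map_upto_snoc_iff[of z' b "z 1"] len z'(2) by simp
      then have "admissible X (b @ [z 1])"
        using admissible_iff[OF assms(2), of "b @ [z 1]" 1] z'(1) len by auto
      \<comment> \<open>Property (D) enters here: \<open>z 1\<close> may follow every past ending in
        \<open>a @ b\<close>. These pasts form a nonempty open cylinder \<open>C\<close>, which
        meets the dense set \<open>E\<close>, where every next symbol has positive weight.\<close>
      then obtain a where a: "admissible X (a @ b)" "[z 1] \<in> omega_plus A X 1 (a @ b)"
        using assms(3) unfolding property_D_def past_context_def by blast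
      obtain w where w: "w \<in> X" "map w [0 + 1 - int (length (a @ b))..0] = a @ b"
        using a(1) admissible_iff[OF assms(2), of "a @ b" 0] by blast
      define C where "C = {y \<in> proj X {..0}. map y [1 - int (length (a @ b))..0] = a @ b}"
      have "C = {y \<in> {..0} \<rightarrow>\<^sub>E A. map y [1 - int (length (a @ b))..0] = a @ b} \<inter> proj X {..0}"
        using proj_subset[OF assms(2), of "{..0}"] by (auto simp: C_def)
      then have "openin P C"
        unfolding P_def by (simp only: openin_subtopology_Int openin_cylinder order_refl)
      moreover have "map (restrict w {..0}) [1 - int (length (a @ b))..0] =
          map w [0 + 1 - int (length (a @ b))..0]"
        by simp
      then have "restrict w {..0} \<in> C"
        unfolding C_def w(2) proj_def using w(1) by blast
      ultimately obtain x where x: "x \<in> E" "x \<in> C"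
        using denseE unfolding dense_intersects_open by blast
      have next_x: "z 1 \<in> next_symbols X x"
        using a(2) x(2) unfolding omega_plus_eq[OF assms(2)] C_def by blast
      moreover have "G x (z 1) > 0"
        using Gf[OF x(1)] next_x next_symbols_subset[OF assms(2), of x] card_pos[of x] x(1) E_sub
        by (auto simp: f_def)
      ultimately have "append_word x [z 1] \<in> ?S"
        using x(1) ED by blast
      \<comment> \<open>A window of \<open>Suc n\<close> letters ending at coordinate 1 consists of
        the \<open>n\<close> letters of \<open>b\<close> followed by \<open>z 1\<close>.\<close>
      moreover have "append_word x [z 1] \<in> U"
      proof (rule n[of "Suc n"])
        show "append_word x [z 1] \<in> {..1} \<rightarrow>\<^sub>E A"
          using next_x proj_subset[OF assms(2), of "{..1}"] next_symbol_iff[of "z 1" X x] by auto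
        have "map x [1 - int (length (a @ b))..0] = a @ b"
          using x(2) by (simp add: C_def)
        then have "map x [1 - int n..0] = b"
          using map_upto_append[of n "length (a @ b)" x] len by simp
        moreover have "map (append_word x [z 1]) [1 - int n..0] = map x [1 - int n..0]"
          by (simp add: append_word_def)
        ultimately have "map (append_word x [z 1]) [1 - int n..1] = b @ [z 1]"
          using map_upto_snoc_iff[of "append_word x [z 1]" b "z 1"] len
          by (simp add: append_word_def)
        moreover have "map z [1 - int n..1] = b @ [z 1]"
          using map_upto_snoc_iff[of z b "z 1"] len by (simp add: b_def)
        ultimately show "map (append_word x [z 1]) [1 + 1 - int (Suc n)..1] = map z [1 + 1 - int (Suc n)..1]"
          by simp
      qed simp
      ultimately show "\<exists>y. y \<in> ?S \<and> y \<in> U"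
        by blast
    qed
    ultimately show "proj X {..1} = seq_topology A {..1} closure_of ?S"
      by blast
  qed
  then show ?thesis
    by blast
qed

theorem proposition3p1:
  fixes A :: "'a set" and X :: "(int \<Rightarrow> 'a) set"
  assumes "finite A"
    and "subshift A X"
  shows "(\<exists>D g. residually_defined_g_function A X D g) \<longleftrightarrow> property_D A X"
  using g_function_imp_property_D[OF assms] property_D_imp_g_function[OF assms] by blast

end
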